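(* Let $(P,\rho)$ be a weakly ranked locally finite poset, $\kappa$ a $(P,\rho)$-kernel with right KLS function $f$, left KLS function $g$, and Chow function $\mathrm{H}$. Then for all $s\le t$ in $P$, $$\mathrm{H}_{st}(x)=\sum_{s\le p_0<p_1<\dots<p_m=t}f_{sp_0}(x)\prod_{i=1}^m\frac{f^{\mathrm{rev}}_{p_{i-1}p_i}(x)-xf_{p_{i-1}p_i}(x)}{x-1} =\sum_{s=p_0<p_1<\dots<p_m\le t}\Big(\prod_{i=1}^m\frac{g^{\mathrm{rev}}_{p_{i-1}p_i}(x)-xg_{p_{i-1}p_i}(x)}{x-1}\Big)g_{p_mt}(x),$$ where the sums range over all chains (of any length $m\ge0$) of the indicated form.
   Context: $P$ is a locally finite poset; $\operatorname{Int}(P)$ is its set of closed intervals. A weak rank function is a map $\rho:\operatorname{Int}(P)\to\mathbb{Z}_{\ge0}$, $[s,t]\mapsto\rho_{st}$, with $\rho_{st}>0$ whenever $s<t$ and $\rho_{st}=\rho_{sw}+\rho_{wt}$ for $s\le w\le t$. The incidence algebra $\mathcal{I}(P)$ consists of maps $a$ assigning to each $[s,t]$ a polynomial $a_{st}(x)\in\mathbb{Z}[x]$, with product $(ab)_{st}=\sum_{s\le w\le t}a_{sw}b_{wt}$. $\mathcal{I}_\rho(P)=\{a:\deg a_{st}\le\rho_{st}\}$, and $a^{\mathrm{rev}}_{st}(x)=x^{\rho_{st}}a_{st}(x^{-1})$. A $(P,\rho)$-kernel is $\kappa\in\mathcal{I}_\rho(P)$ with $\kappa_{ss}=1$ for all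 $s$ and $\kappa^{-1}=\kappa^{\mathrm{rev}}$. For $s<t$, $\kappa_{st}$ is divisible by $x-1$; the reduced kernel has $\overline{\kappa}_{st}=\kappa_{st}/(x-1)$ for $s<t$ and $\overline{\kappa}_{ss}=-1$. The Chow function is $\mathrm{H}=-(\overline{\kappa})^{-1}$. The right KLS function is the unique $f\in\mathcal{I}_\rho(P)$ with $f_{ss}=1$, $\deg f_{st}<\rho_{st}/2$ for $s<t$, $f^{\mathrm{rev}}=\kappa f$; the left KLS function is the unique $g\in\mathcal{I}_\rho(P)$ with $g_{ss}=1$, $\deg g_{st}<\rho_{st}/2$ for $s<t$, $g^{\mathrm{rev}}=g\kappa$. *)

theory Defs
  imports "HOL-Computational_Algebra.Polynomial"
begin

text \<open>
  The poset is a type of class order. An element of the incidence algebra is a function of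
  two arguments that vanishes off the closed intervals, so that equality in the incidence
  algebra is equality of functions.
\<close>

definition locally_finite :: "'a::order itself \<Rightarrow> bool" where
  "locally_finite _ \<longleftrightarrow> (\<forall>s t::'a. finite {s..t})"

text \<open>Only the values \<open>\<rho> s t\<close> with \<open>s \<le> t\<close> are relevant.\<close>

definition weak_rank :: "('a::order \<Rightarrow> 'a \<Rightarrow> nat) \<Rightarrow> bool" where
  "weak_rank \<rho> \<longleftrightarrow>
     (\<forall>s t. s < t \<longrightarrow> \<rho> s t > 0) \<and>
     (\<forall>s w t. s \<le> w \<longrightarrow> w \<le> t \<longrightarrow> \<rho> s t = \<rho> s w + \<rho> w t)"

type_synonym 'a inc = "'a \<Rightarrow> 'a \<Rightarrow> int poly"

definition incidence :: "'a::order inc set" where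
  "incidence = {a. \<forall>s t. \<not> s \<le> t \<longrightarrow> a s t = 0}"

definition incidence_rk :: "('a::order \<Rightarrow> 'a \<Rightarrow> nat) \<Rightarrow> 'a inc set" where
  "incidence_rk \<rho> = {a \<in> incidence. \<forall>s t. s \<le> t \<longrightarrow> degree (a s t) \<le> \<rho> s t}"

definition inc_mult :: "'a::order inc \<Rightarrow> 'a inc \<Rightarrow> 'a inc" (infixl \<open>\<star>\<close> 70) where
  "(a \<star> b) s t = (\<Sum>w\<in>{s..t}. a s w * b w t)"

definition inc_one :: "'a::order inc" where
  "inc_one s t = (if s = t then 1 else 0)"

definition is_inc_inverse :: "'a::order inc \<Rightarrow> 'a inc \<Rightarrow> bool" where
  "is_inc_inverse a b \<longleftrightarrow> b \<in> incidence \<and> a \<star> b = inc_one \<and> b \<star> a = inc_one"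

definition inc_inverse :: "'a::order inc \<Rightarrow> 'a inc" where
  "inc_inverse a = (THE b. is_inc_inverse a b)"

text \<open>
  \<open>reflect_poly p\<close> is \<open>x ^ degree p * p(1/x)\<close>; the monomial raises the exponent to
  \<open>\<rho> s t\<close>. This is the intended \<open>x ^ \<rho> s t * a s t (1/x)\<close> for
  \<open>a \<in> incidence_rk \<rho>\<close>, the only case in which it is used.
\<close>

definition inc_rev :: "('a::order \<Rightarrow> 'a \<Rightarrow> nat) \<Rightarrow> 'a inc \<Rightarrow> 'a inc" where
  "inc_rev \<rho> a s t = monom 1 (\<rho> s t - degree (a s t)) * reflect_poly (a s t)"

definition is_kernel :: "('a::order \<Rightarrow> 'a \<Rightarrow> nat) \<Rightarrow> 'a inc \<Rightarrow> bool" where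
  "is_kernel \<rho> \<kappa> \<longleftrightarrow>
     \<kappa> \<in> incidence_rk \<rho> \<and> (\<forall>s. \<kappa> s s = 1) \<and> is_inc_inverse \<kappa> (inc_rev \<rho> \<kappa>)"

text \<open>For a kernel the division by \<open>x - 1\<close> is exact.\<close>

definition reduced_kernel :: "'a::order inc \<Rightarrow> 'a inc" where
  "reduced_kernel \<kappa> s t =
     (if s < t then \<kappa> s t div [:-1, 1:] else if s = t then -1 else 0)"

definition chow :: "'a::order inc \<Rightarrow> 'a inc" where
  "chow \<kappa> s t = - inc_inverse (reduced_kernel \<kappa>) s t"

text \<open>
  Every kernel has exactly one right and one left KLS function. In the degree bounds it is
  harmless that \<open>degree 0 = 0\<close>, since \<open>\<rho> s t > 0\<close> for \<open>s < t\<close>.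
\<close>

definition is_right_KLS :: "('a::order \<Rightarrow> 'a \<Rightarrow> nat) \<Rightarrow> 'a inc \<Rightarrow> 'a inc \<Rightarrow> bool" where
  "is_right_KLS \<rho> \<kappa> f \<longleftrightarrow>
     f \<in> incidence_rk \<rho> \<and> (\<forall>s. f s s = 1) \<and>
     (\<forall>s t. s < t \<longrightarrow> 2 * degree (f s t) < \<rho> s t) \<and> inc_rev \<rho> f = \<kappa> \<star> f"

definition is_left_KLS :: "('a::order \<Rightarrow> 'a \<Rightarrow> nat) \<Rightarrow> 'a inc \<Rightarrow> 'a inc \<Rightarrow> bool" where
  "is_left_KLS \<rho> \<kappa> g \<longleftrightarrow>
     g \<in> incidence_rk \<rho> \<and> (\<forall>s. g s s = 1) \<and>
     (\<forall>s t. s < t \<longrightarrow> 2 * degree (g s t) < \<rho> s t) \<and> inc_rev \<rho> g = g \<star> \<kappa>"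

text \<open>
  A chain \<open>p\<^sub>0 < \<dots> < p\<^sub>m\<close> is the nonempty strictly increasing list of its elements, so
  \<open>m = length ps - 1\<close>. In a locally finite poset both sets below are finite.
\<close>

definition chains_to :: "'a::order \<Rightarrow> 'a \<Rightarrow> 'a list set" where
  "chains_to s t = {ps. ps \<noteq> [] \<and> sorted_wrt (<) ps \<and> s \<le> hd ps \<and> last ps = t}"

definition chains_from :: "'a::order \<Rightarrow> 'a \<Rightarrow> 'a list set" where
  "chains_from s t = {ps. ps \<noteq> [] \<and> sorted_wrt (<) ps \<and> hd ps = s \<and> last ps \<le> t}"

end

theory Submission
  imports Defs
begin

text \<open>
  The matrix \<open>E = (f\<^sup>r\<^sup>e\<^sup>v - x f) / (x - 1)\<close> equals \<open>\<kappa>' \<star> f\<close>, where \<open>\<kappa>'\<close> is the reduced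
  kernel, because \<open>(x - 1) \<kappa>' = \<kappa> - x\<close>. Its diagonal is \<open>-1\<close>, so the geometric series expands
  \<open>-E\<inverse>\<close> as a sum \<open>N\<close> over chains, and \<open>\<kappa>' \<star> f \<star> N = -1\<close> identifies the Chow function with
  \<open>f \<star> N\<close>. The left-handed identity is symmetric.
\<close>

section \<open>The incidence algebra\<close>

lemma incidence_mult: "a \<star> b \<in> incidence"
  by (auto simp: incidence_def inc_mult_def)

text \<open>Finiteness of \<open>{s..t}\<close> matters because a sum over an infinite set is 0 by
  default. Membership in \<open>incidence\<close> settles the pairs whose interval is empty.\<close>

lemma inc_one_mult:
  assumes "locally_finite TYPE('a::order)" "a \<in> incidence"
  shows "inc_one \<star> (a :: 'a inc) = a"
proof (intro ext)
  fix s t :: 'a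
  have "finite {s..t}"
    using assms by (auto simp: locally_finite_def)
  then show "(inc_one \<star> a) s t = a s t"
    using assms(2) by (auto simp: inc_mult_def inc_one_def incidence_def if_distrib[of "\<lambda>c. c * _"] cong: if_cong)
qed

lemma inc_mult_one:
  assumes "locally_finite TYPE('a::order)" "a \<in> incidence"
  shows "(a :: 'a inc) \<star> inc_one = a"
proof (intro ext)
  fix s t :: 'a
  have "finite {s..t}"
    using assms by (auto simp: locally_finite_def)
  then show "(a \<star> inc_one) s t = a s t"
    using assms(2) by (auto simp: inc_mult_def inc_one_def incidence_def if_distrib[of "\<lambda>c. _ * c"] cong: if_cong)
qed

lemma inc_mult_assoc:
  assumes "locally_finite TYPE('a::order)"
  shows "(a :: 'a inc) \<star> b \<star> c = a \<star> (b \<star> c)"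
proof (intro ext)
  fix s t :: 'a
  have fin: "finite {u..v}" for u v :: 'a
    using assms by (auto simp: locally_finite_def)
  have "(a \<star> b \<star> c) s t = (\<Sum>w\<in>{s..t}. \<Sum>v\<in>{s..w}. a s v * b v w * c w t)"
    by (simp add: inc_mult_def sum_distrib_right)
  \<comment> \<open>Both variables now range over \<open>{s..t}\<close>, linked only by
    \<open>v \<le> w\<close>, so the sums can be swapped.\<close>
  also have "\<dots> = (\<Sum>w\<in>{s..t}. \<Sum>v\<in>{v\<in>{s..t}. v \<le> w}. a s v * b v w * c w t)"
    by (intro sum.cong) (auto intro: order_trans)
  also have "\<dots> = (\<Sum>v\<in>{s..t}. \<Sum>w\<in>{w\<in>{s..t}. v \<le> w}. a s v * b v w * c w t)"
    by (rule sum.swap_restrict) (auto simp: fin)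
  also have "\<dots> = (\<Sum>v\<in>{s..t}. \<Sum>w\<in>{v..t}. a s v * b v w * c w t)"
    by (intro sum.cong) (auto intro: order_trans)
  also have "\<dots> = (a \<star> (b \<star> c)) s t"
    by (simp add: inc_mult_def sum_distrib_left mult.assoc)
  finally show "(a \<star> b \<star> c) s t = (a \<star> (b \<star> c)) s t" .
qed

text \<open>Two-sided inverses are unique by the monoid argument, so any exhibited inverse is the
  value of the definite description.\<close>

lemma inc_inverse_eqI:
  assumes "locally_finite TYPE('a::order)" "a \<in> incidence" "is_inc_inverse (a :: 'a inc) b"
  shows "inc_inverse a = b"
  unfolding inc_inverse_def
proof (rule the_equality)
  fix c assume c: "is_inc_inverse a c"
  have "c = c \<star> (a \<star> b)"
    using c assms by (simp add: is_inc_inverse_def inc_mult_one)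
  also have "\<dots> = c \<star> a \<star> b"
    by (simp add: inc_mult_assoc assms)
  also have "\<dots> = b"
    using c assms by (simp add: is_inc_inverse_def inc_one_mult)
  finally show "c = b" .
qed fact

text \<open>For an invertible \<open>a\<close> a one-sided inverse suffices:
  \<open>b = b \<star> (a \<star> c) = (b \<star> a) \<star> c = c\<close>. A candidate for the
  inverse of the reduced kernel then needs checking on one side only.\<close>

lemma inc_inverse_unique_right:
  assumes "locally_finite TYPE('a::order)" "is_inc_inverse (a :: 'a inc) b"
    and "c \<in> incidence" "a \<star> c = inc_one"
  shows "b = c"
  using assms by (metis inc_mult_assoc inc_mult_one inc_one_mult is_inc_inverse_def)

lemma inc_inverse_unique_left:
  assumes "locally_finite TYPE('a::order)" "is_inc_inverse (a :: 'a inc) b"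
    and "c \<in> incidence" "c \<star> a = inc_one"
  shows "b = c"
  using assms by (metis inc_mult_assoc inc_mult_one inc_one_mult is_inc_inverse_def)

section \<open>Inversion by summation over chains\<close>

text \<open>With both ends fixed these sets are the blocks into which \<open>chains_to\<close> and
  \<open>chains_from\<close> split according to their free end.\<close>

definition chains_between :: "'a::order \<Rightarrow> 'a \<Rightarrow> 'a list set" where
  "chains_between s t = {ps. ps \<noteq> [] \<and> sorted_wrt (<) ps \<and> hd ps = s \<and> last ps = t}"

text \<open>The indexing is that of the products in the theorem, so unfolding reproduces them
  literally.\<close>

definition chain_weight :: "'a inc \<Rightarrow> 'a list \<Rightarrow> int poly" where
  "chain_weight d ps = (\<Prod>i=1..<length ps. d (ps ! (i - 1)) (ps ! i))"

text \<open>In a locally finite poset this is the geometric series \<open>1 + n + n^2 + ...\<close>,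
  where \<open>n\<close> is the part of \<open>d\<close> strictly above the diagonal. Diagonal
  values of \<open>d\<close> never enter.\<close>

definition chain_sum :: "'a::order inc \<Rightarrow> 'a inc" where
  "chain_sum d s t = (\<Sum>ps\<in>chains_between s t. chain_weight d ps)"

lemma chain_weight_singleton [simp]: "chain_weight d [s] = 1"
  by (simp add: chain_weight_def)

lemma chain_weight_Cons:
  assumes "ps \<noteq> []"
  shows "chain_weight d (s # ps) = d s (hd ps) * chain_weight d ps"
proof -
  have "chain_weight d (s # ps) = (\<Prod>i=0..<length ps. d ((s # ps) ! i) (ps ! i))"
    unfolding chain_weight_def by (simp only: One_nat_def list.size add_Suc_right add_0_right prod.shift_bounds_Suc_ivl) simp
  also have "\<dots> = d s (hd ps) * (\<Prod>i=1..<length ps. d ((s # ps) ! i) (ps ! i))"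
    using assms by (simp add: prod.atLeast_Suc_lessThan hd_conv_nth)
  \<comment> \<open>For \<open>i \<ge> 1\<close> the entry \<open>(s # ps) ! i\<close> is
    \<open>ps ! (i - 1)\<close>; the factor at \<open>i = 0\<close> has been split off.\<close>
  also have "(\<Prod>i=1..<length ps. d ((s # ps) ! i) (ps ! i)) = chain_weight d ps"
    unfolding chain_weight_def by (intro prod.cong) (auto simp: nth_Cons')
  finally show ?thesis .
qed

lemma chain_weight_snoc:
  assumes "ps \<noteq> []"
  shows "chain_weight d (ps @ [t]) = chain_weight d ps * d (last ps) t"
proof -
  have "chain_weight d (ps @ [t]) =
      (\<Prod>i=1..<length ps. d ((ps @ [t]) ! (i - 1)) ((ps @ [t]) ! i)) * d (last ps) t"
    using assms by (simp add: chain_weight_def prod.atLeastLessThan_Suc nth_append last_conv_nth Suc_le_eq)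
  also have "(\<Prod>i=1..<length ps. d ((ps @ [t]) ! (i - 1)) ((ps @ [t]) ! i)) = chain_weight d ps"
    unfolding chain_weight_def by (intro prod.cong) (auto simp: nth_append)
  finally show ?thesis .
qed

section \<open>Strict chains inside an interval and their decompositions\<close>

lemma sorted_wrt_less_bounds:
  fixes ps :: "'a::order list"
  assumes "sorted_wrt (<) ps" "x \<in> set ps"
  shows "hd ps \<le> x" "x \<le> last ps"
proof -
  show "hd ps \<le> x"
    using assms by (cases ps) (auto simp: less_imp_le)
  show "x \<le> last ps"
    using assms by (cases ps rule: rev_cases) (auto simp: sorted_wrt_append less_imp_le)
qed

lemma sorted_wrt_less_distinct:
  "sorted_wrt (<) ps \<Longrightarrow> distinct (ps :: 'a::order list)"
  by (induction ps) auto

lemma chains_between_le: "ps \<in> chains_between s t \<Longrightarrow> s \<le> t"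
  using sorted_wrt_less_bounds(1)[of ps "last ps"] by (auto simp: chains_between_def)

text \<open>A strict chain is a duplicate-free list over the finite set
  \<open>{s..t}\<close>.\<close>

lemma finite_chains_between:
  assumes "locally_finite TYPE('a::order)"
  shows "finite (chains_between s (t::'a))"
proof (rule finite_subset)
  show "chains_between s t \<subseteq> {ps. set ps \<subseteq> {s..t} \<and> distinct ps}"
    using sorted_wrt_less_bounds sorted_wrt_less_distinct by (fastforce simp: chains_between_def)
  show "finite {ps. set ps \<subseteq> {s..t} \<and> distinct ps}"
    using assms by (intro finite_subset_distinct) (auto simp: locally_finite_def)
qed

lemma chains_between_refl: "chains_between s s = {[s]}"
proof -
  have "ps = [s]" if "ps \<in> chains_between s s" for ps
  proof -
    from that obtain qs where qs: "ps = s # qs"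
      by (cases ps) (auto simp: chains_between_def)
    have "qs = []"
    proof (rule ccontr)
      assume "qs \<noteq> []"
      with that qs have "last qs \<in> set qs" "\<forall>x\<in>set qs. s < x" "last qs = s"
        by (auto simp: chains_between_def)
      then show False
        by auto
    qed
    with qs show ?thesis
      by simp
  qed
  then show ?thesis
    by (auto simp: chains_between_def)
qed

lemma chain_sum_refl [simp]: "chain_sum d s s = 1"
  by (simp add: chain_sum_def chains_between_refl)

lemma chain_sum_incidence: "chain_sum (d :: 'a::order inc) \<in> incidence"
proof -
  have "chains_between s t = {}" if "\<not> s \<le> t" for s t :: 'a
    using that chains_between_le by blast
  then show ?thesis
    by (simp add: incidence_def chain_sum_def)
qed

text \<open>Since \<open>s < t\<close>, a chain has at least two elements; \<open>w\<close> is the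
  second one.\<close>

lemma chains_between_eq_Cons:
  assumes "s < t"
  shows "chains_between s t = (\<Union>w\<in>{s<..t}. (#) s ` chains_between w t)"
proof (intro set_eqI iffI)
  fix ps assume ps: "ps \<in> chains_between s t"
  then obtain qs where qs: "ps = s # qs"
    by (cases ps) (auto simp: chains_between_def)
  with ps assms have ne: "qs \<noteq> []"
    by (auto simp: chains_between_def)
  with ps qs have hd: "qs \<in> chains_between (hd qs) t" "s < hd qs"
    by (auto simp: chains_between_def)
  show "ps \<in> (\<Union>w\<in>{s<..t}. (#) s ` chains_between w t)"
    unfolding qs using hd chains_between_le[OF hd(1)] by (intro UN_I[of "hd qs"]) auto
next
  fix ps assume "ps \<in> (\<Union>w\<in>{s<..t}. (#) s ` chains_between w t)"
  then obtain qs where qs: "ps = s # qs" "s < hd qs" "qs \<in> chains_between (hd qs) t"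
    by (auto simp: chains_between_def)
  then have "s < x" if "x \<in> set qs" for x
    using that sorted_wrt_less_bounds(1)[of qs x] by (auto simp: chains_between_def)
  with qs show "ps \<in> chains_between s t"
    by (auto simp: chains_between_def)
qed

lemma chains_between_eq_snoc:
  assumes "s < t"
  shows "chains_between s t = (\<Union>w\<in>{s..<t}. (\<lambda>ps. ps @ [t]) ` chains_between s w)"
proof (intro set_eqI iffI)
  fix ps assume ps: "ps \<in> chains_between s t"
  then obtain qs where qs: "ps = qs @ [t]"
    by (cases ps rule: rev_cases) (auto simp: chains_between_def)
  with ps assms have ne: "qs \<noteq> []"
    by (auto simp: chains_between_def)
  with ps qs have last: "qs \<in> chains_between s (last qs)" "last qs < t"
    by (auto simp: chains_between_def sorted_wrt_append)
  show "ps \<in> (\<Union>w\<in>{s..<t}. (\<lambda>ps. ps @ [t]) ` chains_between s w)"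
    unfolding qs using last chains_between_le[OF last(1)] by (intro UN_I[of "last qs"]) auto
next
  fix ps assume "ps \<in> (\<Union>w\<in>{s..<t}. (\<lambda>ps. ps @ [t]) ` chains_between s w)"
  then obtain qs where qs: "ps = qs @ [t]" "last qs < t" "qs \<in> chains_between s (last qs)"
    by (auto simp: chains_between_def)
  then have "x < t" if "x \<in> set qs" for x
    using that sorted_wrt_less_bounds(2)[of qs x] by (auto simp: chains_between_def)
  with qs show "ps \<in> chains_between s t"
    by (auto simp: chains_between_def sorted_wrt_append)
qed

text \<open>Grouping the chains by their second element gives the recursion of the geometric series,
  \<open>N = 1 + n \<star> N\<close>, off the diagonal.\<close>

lemma chain_sum_first_step:
  assumes lf: "locally_finite TYPE('a::order)" and "s < (t::'a)"
  shows "chain_sum d s t = (\<Sum>w\<in>{s<..t}. d s w * chain_sum d w t)"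
proof -
  have fin: "finite {s<..t}"
    using lf by (intro finite_subset[of "{s<..t}" "{s..t}"]) (auto simp: locally_finite_def)
  have "chain_sum d s t = (\<Sum>w\<in>{s<..t}. \<Sum>ps\<in>(#) s ` chains_between w t. chain_weight d ps)"
    unfolding chain_sum_def chains_between_eq_Cons[OF assms(2)]
    \<comment> \<open>The blocks are disjoint because the second element of a chain determines
      \<open>w\<close>.\<close>
    by (rule sum.UNION_disjoint) (simp add: fin, simp add: finite_chains_between[OF lf], auto simp: chains_between_def)
  also have "\<dots> = (\<Sum>w\<in>{s<..t}. d s w * chain_sum d w t)"
    unfolding chain_sum_def sum_distrib_left
    by (rule sum.cong[OF refl], subst sum.reindex) (auto simp: chain_weight_Cons chains_between_def intro!: sum.cong)
  finally show ?thesis .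
qed

lemma chain_sum_last_step:
  assumes lf: "locally_finite TYPE('a::order)" and "s < (t::'a)"
  shows "chain_sum d s t = (\<Sum>w\<in>{s..<t}. chain_sum d s w * d w t)"
proof -
  have fin: "finite {s..<t}"
    using lf by (intro finite_subset[of "{s..<t}" "{s..t}"]) (auto simp: locally_finite_def)
  have "chain_sum d s t = (\<Sum>w\<in>{s..<t}. \<Sum>ps\<in>(\<lambda>ps. ps @ [t]) ` chains_between s w. chain_weight d ps)"
    unfolding chain_sum_def chains_between_eq_snoc[OF assms(2)]
    by (rule sum.UNION_disjoint) (simp add: fin, simp add: finite_chains_between[OF lf], auto simp: chains_between_def)
  also have "\<dots> = (\<Sum>w\<in>{s..<t}. chain_sum d s w * d w t)"
    unfolding chain_sum_def sum_distrib_right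
    by (rule sum.cong[OF refl], subst sum.reindex)
      (auto simp: chain_weight_snoc chains_between_def inj_on_def intro!: sum.cong)
  finally show ?thesis .
qed

text \<open>For \<open>s < t\<close> the diagonal entry -1 contributes one term
  \<open>chain_sum a s t\<close> to the product, and the first-step or last-step recursion makes the
  remaining terms its negative.\<close>

lemma is_inc_inverse_chain_sum:
  assumes lf: "locally_finite TYPE('a::order)" and diag: "\<And>s::'a. a s s = - 1"
  shows "is_inc_inverse a (\<lambda>s t. - chain_sum a s t)"
  unfolding is_inc_inverse_def
proof (intro conjI ext)
  show "(\<lambda>s t. - chain_sum a s t) \<in> incidence"
    using chain_sum_incidence[of a] by (simp add: incidence_def)
next
  fix s t :: 'a
  have fin: "finite {s..t}"
    using lf by (auto simp: locally_finite_def)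
  consider "s = t" | "s < t" | "\<not> s \<le> t"
    by (auto simp: less_le)
  note cases = this
  show "(a \<star> (\<lambda>s t. - chain_sum a s t)) s t = inc_one s t"
  proof (cases rule: cases)
    case 2
    then have "{s..t} = insert s {s<..t}"
      by auto
    with 2 fin show ?thesis
      by (simp add: inc_mult_def inc_one_def diag sum_negf chain_sum_first_step[OF lf 2])
  qed (auto simp: inc_mult_def inc_one_def diag)
  show "((\<lambda>s t. - chain_sum a s t) \<star> a) s t = inc_one s t"
  proof (cases rule: cases)
    case 2
    then have "{s..t} = insert t {s..<t}"
      by auto
    with 2 fin show ?thesis
      by (simp add: inc_mult_def inc_one_def diag sum_negf chain_sum_last_step[OF lf 2])
  qed (auto simp: inc_mult_def inc_one_def diag)
qed

text \<open>The summation variable \<open>w\<close> of the product is the least element of the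
  chain, which in \<open>chains_to s t\<close> is free to vary over \<open>{s..t}\<close>.\<close>

lemma inc_mult_chain_sum_eq:
  assumes lf: "locally_finite TYPE('a::order)"
  shows "(a \<star> chain_sum d) s (t::'a) = (\<Sum>ps\<in>chains_to s t. a s (hd ps) * chain_weight d ps)"
proof -
  have fin: "finite {s..t}"
    using lf by (auto simp: locally_finite_def)
  have eq: "chains_to s t = (\<Union>w\<in>{s..t}. chains_between w t)"
    using chains_between_le by (fastforce simp: chains_to_def chains_between_def)
  have "(\<Sum>ps\<in>chains_to s t. a s (hd ps) * chain_weight d ps) =
      (\<Sum>w\<in>{s..t}. \<Sum>ps\<in>chains_between w t. a s (hd ps) * chain_weight d ps)"
    unfolding eq
    by (rule sum.UNION_disjoint) (simp add: fin, simp add: finite_chains_between[OF lf], auto simp: chains_between_def)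
  also have "\<dots> = (a \<star> chain_sum d) s t"
    unfolding inc_mult_def chain_sum_def sum_distrib_left
    by (intro sum.cong refl) (auto simp: chains_between_def)
  finally show ?thesis ..
qed

lemma chain_sum_inc_mult_eq:
  assumes lf: "locally_finite TYPE('a::order)"
  shows "(chain_sum d \<star> a) s (t::'a) = (\<Sum>ps\<in>chains_from s t. chain_weight d ps * a (last ps) t)"
proof -
  have fin: "finite {s..t}"
    using lf by (auto simp: locally_finite_def)
  have eq: "chains_from s t = (\<Union>w\<in>{s..t}. chains_between s w)"
    using chains_between_le by (fastforce simp: chains_from_def chains_between_def)
  have "(\<Sum>ps\<in>chains_from s t. chain_weight d ps * a (last ps) t) =
      (\<Sum>w\<in>{s..t}. \<Sum>ps\<in>chains_between s w. chain_weight d ps * a (last ps) t)"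
    unfolding eq
    by (rule sum.UNION_disjoint) (simp add: fin, simp add: finite_chains_between[OF lf], auto simp: chains_between_def)
  also have "\<dots> = (chain_sum d \<star> a) s t"
    unfolding inc_mult_def chain_sum_def sum_distrib_right
    by (intro sum.cong refl) (auto simp: chains_between_def)
  finally show ?thesis ..
qed

section \<open>The reduced kernel\<close>

lemma poly_reflect_poly_1: "poly (reflect_poly p) (1 :: 'a::comm_semiring_1) = poly p 1"
proof -
  have "poly (reflect_poly p) 1 = (\<Sum>i\<le>degree p. coeff (reflect_poly p) i)"
    \<comment> \<open>Reflection lowers the degree when the constant coefficient of a nonzero
      \<open>p\<close> vanishes; the sum is padded with zero coefficients up to
      \<open>degree p\<close>, after which reversal merely permutes the terms.\<close>
    unfolding poly_altdef using degree_reflect_poly_le[of p]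
    by (intro sum.mono_neutral_cong_left) (auto simp: coeff_eq_0)
  also have "\<dots> = (\<Sum>i\<le>degree p. coeff p (degree p - i))"
    by (intro sum.cong) (simp_all add: coeff_reflect_poly)
  also have "\<dots> = (\<Sum>i\<le>degree p. coeff p i)"
    by (rule sum.reindex_bij_witness[of _ "\<lambda>i. degree p - i" "\<lambda>i. degree p - i"]) auto
  finally show ?thesis
    by (simp add: poly_altdef)
qed

lemma poly_inc_rev_1: "poly (inc_rev \<rho> a s t) 1 = poly (a s t) 1"
  by (simp add: inc_rev_def poly_monom poly_reflect_poly_1)

text \<open>Reversal is invisible at x = 1, so there the kernel is its own inverse. In the product
  at \<open>s < t\<close> the inner terms vanish by induction on the size of the interval, and the
  two ends leave \<open>2 * poly (\<kappa> s t) 1 = 0\<close> over the integers.\<close>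

lemma kernel_root_1:
  assumes lf: "locally_finite TYPE('a::order)" and \<kappa>: "is_kernel \<rho> \<kappa>" and "s < (t::'a)"
  shows "poly (\<kappa> s t) 1 = 0"
  using \<open>s < t\<close>
proof (induction "card {s..t}" arbitrary: s t rule: less_induct)
  case less
  have fin: "finite {s..t}"
    using lf by (auto simp: locally_finite_def)
  \<comment> \<open>Intervals with the same bottom suffice, since each inner term contains a factor
    \<open>\<kappa> s w\<close>.\<close>
  have mid: "poly (\<kappa> s w) 1 = 0" if "s < w" "w < t" for w
  proof (rule less.hyps)
    have "t \<in> {s..t}" "t \<notin> {s..w}" "{s..w} \<subseteq> {s..t}"
      using that less.prems by auto
    then show "card {s..w} < card {s..t}"
      by (intro psubset_card_mono fin) blast
  qed fact
  have "0 = poly ((\<kappa> \<star> inc_rev \<rho> \<kappa>) s t) 1"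
    using \<kappa> less.prems by (simp add: is_kernel_def is_inc_inverse_def inc_one_def)
  also have "\<dots> = (\<Sum>w\<in>{s..t}. poly (\<kappa> s w) 1 * poly (\<kappa> w t) 1)"
    by (simp add: inc_mult_def poly_sum poly_inc_rev_1)
  also have "\<dots> = (\<Sum>w\<in>{s, t}. poly (\<kappa> s w) 1 * poly (\<kappa> w t) 1)"
    using mid less.prems fin by (intro sum.mono_neutral_right) (auto simp: less_le)
  also have "\<dots> = 2 * poly (\<kappa> s t) 1"
    using \<kappa> less.prems by (simp add: is_kernel_def)
  finally show ?case
    by simp
qed

text \<open>The value -1 on the diagonal of the reduced kernel makes this uniform in
  \<open>s\<close> and \<open>t\<close>: there both sides are \<open>1 - x\<close>. Above the
  diagonal it is exactness of the division, from the root at 1.\<close>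

lemma reduced_kernel_mult:
  assumes "locally_finite TYPE('a::order)" "is_kernel \<rho> \<kappa>"
  shows "[:-1, 1:] * reduced_kernel \<kappa> s (t::'a) = \<kappa> s t - [:0, 1:] * inc_one s t"
proof -
  consider "s = t" | "s < t" | "\<not> s \<le> t"
    by (auto simp: less_le)
  then show ?thesis
  proof cases
    case 1
    then show ?thesis
      using assms(2) by (simp add: reduced_kernel_def inc_one_def is_kernel_def one_pCons)
  next
    case 2
    then have "[:-1, 1:] dvd \<kappa> s t"
      using kernel_root_1[OF assms] by (simp add: poly_eq_0_iff_dvd)
    with 2 show ?thesis
      by (simp only: reduced_kernel_def inc_one_def dvd_mult_div_cancel if_True less_imp_neq if_False mult_zero_right diff_zero)
  next
    case 3
    then have "\<kappa> s t = 0"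
      using assms(2) by (auto simp: is_kernel_def incidence_rk_def incidence_def)
    with 3 show ?thesis
      by (auto simp: reduced_kernel_def inc_one_def)
  qed
qed

lemma reduced_kernel_incidence: "reduced_kernel \<kappa> \<in> incidence"
  by (auto simp: incidence_def reduced_kernel_def)

text \<open>Multiplying \<open>(x - 1) \<kappa>' = \<kappa> - x\<close> on the right by
  \<open>f\<close> and cancelling \<open>x - 1\<close> shows that the division is exact. For a right
  KLS function the quotient is the factor in the theorem.\<close>

lemma reduced_kernel_inc_mult:
  assumes lf: "locally_finite TYPE('a::order)" and "is_kernel \<rho> \<kappa>" and f: "f \<in> incidence"
  shows "(reduced_kernel \<kappa> \<star> f) s (t::'a) = ((\<kappa> \<star> f) s t - [:0, 1:] * f s t) div [:-1, 1:]"
proof -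
  have "[:-1, 1:] * (reduced_kernel \<kappa> \<star> f) s t =
      (\<Sum>w\<in>{s..t}. [:-1, 1:] * reduced_kernel \<kappa> s w * f w t)"
    by (simp only: inc_mult_def sum_distrib_left mult.assoc)
  also have "\<dots> = (\<kappa> \<star> f) s t - [:0, 1:] * (inc_one \<star> f) s t"
    by (simp only: reduced_kernel_mult[OF assms(1,2)] inc_mult_def sum_distrib_left
        left_diff_distrib sum_subtractf mult.assoc)
  finally have eq: "(\<kappa> \<star> f) s t - [:0, 1:] * f s t = [:-1, 1:] * (reduced_kernel \<kappa> \<star> f) s t"
    by (simp only: inc_one_mult[OF lf f])
  show ?thesis
    unfolding eq by (rule nonzero_mult_div_cancel_left[symmetric]) simp
qed

lemma inc_mult_reduced_kernel:
  assumes lf: "locally_finite TYPE('a::order)" and "is_kernel \<rho> \<kappa>" and g: "g \<in> incidence"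
  shows "(g \<star> reduced_kernel \<kappa>) s (t::'a) = ((g \<star> \<kappa>) s t - [:0, 1:] * g s t) div [:-1, 1:]"
proof -
  have "[:-1, 1:] * (g \<star> reduced_kernel \<kappa>) s t =
      (\<Sum>w\<in>{s..t}. g s w * ([:-1, 1:] * reduced_kernel \<kappa> w t))"
    by (simp only: inc_mult_def sum_distrib_left mult.left_commute)
  also have "\<dots> = (g \<star> \<kappa>) s t - [:0, 1:] * (g \<star> inc_one) s t"
    by (simp only: reduced_kernel_mult[OF assms(1,2)] inc_mult_def sum_distrib_left
        right_diff_distrib sum_subtractf mult.left_commute)
  finally have eq: "(g \<star> \<kappa>) s t - [:0, 1:] * g s t = [:-1, 1:] * (g \<star> reduced_kernel \<kappa>) s t"
    by (simp only: inc_mult_one[OF lf g])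
  show ?thesis
    unfolding eq by (rule nonzero_mult_div_cancel_left[symmetric]) simp
qed

text \<open>The chain sum of the reduced kernel itself supplies the inverse that the definite
  description in \<open>chow\<close> presupposes.\<close>

lemma is_inc_inverse_reduced_kernel:
  assumes lf: "locally_finite TYPE('a::order)"
  shows "is_inc_inverse (reduced_kernel \<kappa>) (\<lambda>s (t::'a). - chow \<kappa> s t)"
proof -
  have inv: "is_inc_inverse (reduced_kernel \<kappa>) (\<lambda>s t. - chain_sum (reduced_kernel \<kappa>) s t)"
    by (rule is_inc_inverse_chain_sum[OF lf]) (simp add: reduced_kernel_def)
  then show ?thesis
    using inc_inverse_eqI[OF lf reduced_kernel_incidence inv] by (simp add: chow_def)
qed

section \<open>Factorizations of the Chow function\<close>

lemma inc_mult_uminus_right: "a \<star> (\<lambda>s t. - b s t) = (\<lambda>s t. - (a \<star> b) s t)"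
  by (intro ext) (simp add: inc_mult_def sum_negf)

lemma inc_mult_uminus_left: "(\<lambda>s t. - a s t) \<star> b = (\<lambda>s t. - (a \<star> b) s t)"
  by (intro ext) (simp add: inc_mult_def sum_negf)

lemma chow_eq_inc_mult_chain_sum:
  assumes lf: "locally_finite TYPE('a::order)" and f: "\<And>s::'a. f s s = 1"
  shows "chow \<kappa> = f \<star> chain_sum (reduced_kernel \<kappa> \<star> f)"
proof -
  let ?e = "reduced_kernel \<kappa> \<star> f"
  have "?e s s = - 1" for s
    by (simp add: inc_mult_def reduced_kernel_def f)
  then have "is_inc_inverse ?e (\<lambda>s t. - chain_sum ?e s t)"
    by (rule is_inc_inverse_chain_sum[OF lf])
  \<comment> \<open>Associativity moves \<open>f\<close> from the inverted element to its inverse,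
    giving a right inverse of the reduced kernel.\<close>
  then have "reduced_kernel \<kappa> \<star> (f \<star> (\<lambda>s t. - chain_sum ?e s t)) = inc_one"
    by (simp add: is_inc_inverse_def inc_mult_assoc[OF lf])
  then have "(\<lambda>s t. - chow \<kappa> s t) = f \<star> (\<lambda>s t. - chain_sum ?e s t)"
    by (rule inc_inverse_unique_right[OF lf is_inc_inverse_reduced_kernel[OF lf] incidence_mult])
  then show ?thesis
    by (simp add: inc_mult_uminus_right fun_eq_iff)
qed

lemma chow_eq_chain_sum_inc_mult:
  assumes lf: "locally_finite TYPE('a::order)" and g: "\<And>s::'a. g s s = 1"
  shows "chow \<kappa> = chain_sum (g \<star> reduced_kernel \<kappa>) \<star> g"
proof -
  let ?e = "g \<star> reduced_kernel \<kappa>"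
  have "?e s s = - 1" for s
    by (simp add: inc_mult_def reduced_kernel_def g)
  then have "is_inc_inverse ?e (\<lambda>s t. - chain_sum ?e s t)"
    by (rule is_inc_inverse_chain_sum[OF lf])
  \<comment> \<open>Here \<open>g\<close> stands to the left of the reduced kernel, so regrouping
    yields a left inverse.\<close>
  then have "((\<lambda>s t. - chain_sum ?e s t) \<star> g) \<star> reduced_kernel \<kappa> = inc_one"
    by (simp add: is_inc_inverse_def inc_mult_assoc[OF lf])
  then have "(\<lambda>s t. - chow \<kappa> s t) = (\<lambda>s t. - chain_sum ?e s t) \<star> g"
    by (rule inc_inverse_unique_left[OF lf is_inc_inverse_reduced_kernel[OF lf] incidence_mult])
  then show ?thesis
    by (simp add: inc_mult_uminus_left fun_eq_iff)
qed

theorem theorem3p10: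
  fixes \<rho> :: "'a::order \<Rightarrow> 'a \<Rightarrow> nat"
    and \<kappa> f g :: "'a \<Rightarrow> 'a \<Rightarrow> int poly"
    and s t :: 'a
  assumes "locally_finite TYPE('a)"
    and "weak_rank \<rho>"
    and "is_kernel \<rho> \<kappa>"
    and "is_right_KLS \<rho> \<kappa> f"
    and "is_left_KLS \<rho> \<kappa> g"
    and "s \<le> t"
  shows "chow \<kappa> s t =
      (\<Sum>ps\<in>chains_to s t. f s (hd ps) *
        (\<Prod>i=1..<length ps.
          (inc_rev \<rho> f (ps ! (i - 1)) (ps ! i) - [:0, 1:] * f (ps ! (i - 1)) (ps ! i))
            div [:-1, 1:]))
    \<and> chow \<kappa> s t =
      (\<Sum>ps\<in>chains_from s t.
        (\<Prod>i=1..<length ps.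
          (inc_rev \<rho> g (ps ! (i - 1)) (ps ! i) - [:0, 1:] * g (ps ! (i - 1)) (ps ! i))
            div [:-1, 1:]) * g (last ps) t)"
proof
  note lf = assms(1) and \<kappa> = assms(3)
  have f: "f \<in> incidence" "\<And>s. f s s = 1" "inc_rev \<rho> f = \<kappa> \<star> f"
    using assms(4) by (auto simp: is_right_KLS_def incidence_rk_def)
  have g: "g \<in> incidence" "\<And>s. g s s = 1" "inc_rev \<rho> g = g \<star> \<kappa>"
    using assms(5) by (auto simp: is_left_KLS_def incidence_rk_def)
  show "chow \<kappa> s t =
      (\<Sum>ps\<in>chains_to s t. f s (hd ps) *
        (\<Prod>i=1..<length ps.
          (inc_rev \<rho> f (ps ! (i - 1)) (ps ! i) - [:0, 1:] * f (ps ! (i - 1)) (ps ! i))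
            div [:-1, 1:]))"
    \<comment> \<open>The KLS equation \<open>f(3)\<close> replaces each reversal by an entry of
      \<open>\<kappa> \<star> f\<close>, which is the form that the chain weights take on the other
      side; both sides then coincide.\<close>
    unfolding chow_eq_inc_mult_chain_sum[where f = f, OF lf f(2)] inc_mult_chain_sum_eq[OF lf]
      chain_weight_def reduced_kernel_inc_mult[OF lf \<kappa> f(1)] f(3) ..
  show "chow \<kappa> s t =
      (\<Sum>ps\<in>chains_from s t.
        (\<Prod>i=1..<length ps.
          (inc_rev \<rho> g (ps ! (i - 1)) (ps ! i) - [:0, 1:] * g (ps ! (i - 1)) (ps ! i))
            div [:-1, 1:]) * g (last ps) t)"
    unfolding chow_eq_chain_sum_inc_mult[where g = g, OF lf g(2)] chain_sum_inc_mult_eq[OF lf]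
      chain_weight_def inc_mult_reduced_kernel[OF lf \<kappa> g(1)] g(3) ..
qed

end
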